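(* Let $\Theta$ be a nonempty compact Hausdorff space and let $g_0,g_1,\dots,g_m,\tilde g_1,\dots,\tilde g_m:\Theta\to\mathbb{R}$ be continuous, with $\tilde g_i\ge g_i$ on $\Theta$ for each $i\in\{1,\dots,m\}$. Then the proxy-Lagrangian game, in which the $\theta$-player chooses from $\Theta$ to minimize $\mathcal{L}_\theta$ and the $\lambda$-player chooses from $\Delta^{m+1}$ to maximize $\mathcal{L}_\lambda$, has a mixed Nash equilibrium pair $(\theta,\lambda)$ where $\theta$ is a random variable supported on at most $m+1$ elements of $\Theta$ and $\lambda\in\Delta^{m+1}$ is non-random.
   Context: $\Delta^{m+1}:=\{\lambda\in\mathbb{R}_+^{m+1}:\sum_{j=1}^{m+1}\lambda_j=1\}$. The proxy-Lagrangians on $\Theta\times\Delta^{m+1}$ are $$\mathcal{L}_\theta(\theta,\lambda):=\lambda_1g_0(\theta)+\sum_{i=1}^m\lambda_{i+1}\tilde g_i(\theta),\qquad\mathcal{L}_\lambda(\theta,\lambda):=\sum_{i=1}^m\lambda_{i+1}g_i(\theta).$$ A pair consisting of a $\Theta$-valued random variable $\theta$ and a non-random $\lambda\in\Delta^{m+1}$ is a mixed Nash equilibrium if $$\mathbb{E}_\theta[\mathcal{L}_\theta(\theta,\lambda)]=\min_{\theta^*\in\Theta}\mathcal{L}_\theta(\theta^*,\lambda)\quad\text{and}\quad\mathbb{E}_\theta[\mathcal{L}_\lambda(\theta,\lambda)]=\max_{\lambda^*\in\Delta^{m+1}}\mathbb{E}_\theta[\mathcal{L}_\lambda(\theta,\lambda^*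 )].$$ *)

theory Defs
  imports "HOL-Probability.Probability" "HOL-Homology.Simplices"
begin

(* g 0 is the objective, g i (1 <= i <= m) are the constraints and gt i their proxies;
   only these indices matter. The vector l in R^{m+1} is indexed from 0, as in the library's
   standard_simplex m, so that l 0 weights the objective and l i the i-th constraint. *)
definition lagr_theta ::
  "nat \<Rightarrow> (nat \<Rightarrow> 'a \<Rightarrow> real) \<Rightarrow> (nat \<Rightarrow> 'a \<Rightarrow> real) \<Rightarrow> 'a \<Rightarrow> (nat \<Rightarrow> real) \<Rightarrow> real" where
  "lagr_theta m g gt x l = l 0 * g 0 x + (\<Sum>i\<in>{1..m}. l i * gt i x)"

definition lagr_lambda ::
  "nat \<Rightarrow> (nat \<Rightarrow> 'a \<Rightarrow> real) \<Rightarrow> 'a \<Rightarrow> (nat \<Rightarrow> real) \<Rightarrow> real" where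
  "lagr_lambda m g x l = (\<Sum>i\<in>{1..m}. l i * g i x)"

(* Attained minimum and maximum; the library's Min and Max are for finite sets only. *)
definition is_minimum :: "real \<Rightarrow> real set \<Rightarrow> bool" where
  "is_minimum v S \<longleftrightarrow> v \<in> S \<and> (\<forall>w\<in>S. v \<le> w)"

definition is_maximum :: "real \<Rightarrow> real set \<Rightarrow> bool" where
  "is_maximum v S \<longleftrightarrow> v \<in> S \<and> (\<forall>w\<in>S. w \<le> v)"

definition borel_on :: "'a topology \<Rightarrow> 'a measure" where
  "borel_on T = sigma (topspace T) {U. openin T U}"

(* The random variable is X on the probability space M. For T compact and continuous g, gt
   both Lagrangians are bounded and Borel in the first argument, so the integrals below are
   genuine expectations. *)
definition mixed_nash ::
  "'a topology \<Rightarrow> nat \<Rightarrow> (nat \<Rightarrow> 'a \<Rightarrow> real) \<Rightarrow> (nat \<Rightarrow> 'a \<Rightarrow> real) \<Rightarrow>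
   'w measure \<Rightarrow> ('w \<Rightarrow> 'a) \<Rightarrow> (nat \<Rightarrow> real) \<Rightarrow> bool" where
  "mixed_nash T m g gt M X l \<longleftrightarrow>
     prob_space M \<and> X \<in> M \<rightarrow>\<^sub>M borel_on T \<and> l \<in> standard_simplex m \<and>
     is_minimum (\<integral>w. lagr_theta m g gt (X w) l \<partial>M)
       ((\<lambda>x. lagr_theta m g gt x l) ` topspace T) \<and>
     is_maximum (\<integral>w. lagr_lambda m g (X w) l \<partial>M)
       ((\<lambda>l'. \<integral>w. lagr_lambda m g (X w) l' \<partial>M) ` standard_simplex m)"

(* Almost-sure support; no measurability of S is needed, but finite subsets of a Hausdorff
   space are Borel. *)
definition supported_on_at_most ::
  "'a topology \<Rightarrow> 'w measure \<Rightarrow> ('w \<Rightarrow> 'a) \<Rightarrow> nat \<Rightarrow> bool" where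
  "supported_on_at_most T M X k \<longleftrightarrow>
     (\<exists>S. S \<subseteq> topspace T \<and> finite S \<and> card S \<le> k \<and> (AE w in M. X w \<in> S))"

end

theory Submission
  imports Defs
begin

text \<open>
  Brouwer's theorem for the standard simplex, applied to Nash's map, solves every variational
  inequality for the \<open>\<lambda>\<close>-player with continuous data. The best reply of the \<open>\<theta>\<close>-player is not
  continuous in \<open>\<lambda>\<close>, but if \<open>\<Theta>\<close> is replaced by a finite subset \<open>S\<close>, then the minimizers of
  \<open>L\<^sub>\<theta>(\<cdot>, \<lambda>)\<close> on \<open>S\<close> up to \<open>\<epsilon>\<close> carry weights that depend continuously on \<open>\<lambda>\<close>. This
  gives an \<open>\<epsilon>\<close>-equilibrium on \<open>S\<close>, and Caratheodory's argument reduces the number of its atoms to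
  \<open>m + 1\<close>. The equilibrium conditions against a single \<open>y \<in> \<Theta>\<close> up to \<open>\<epsilon>\<close> define closed subsets of
  the compact space of tuples (\<open>\<lambda>\<close>, weights, \<open>m + 1\<close> atoms), which therefore have the finite
  intersection property; a common point is an equilibrium.
\<close>

section \<open>Coordinates and the standard simplex\<close>

lemma continuous_on_coordinate:
  "continuous_on S (\<lambda>x. x i :: 'b::topological_space)"
  by (rule continuous_on_subset[OF continuous_on_product_coordinates]) simp

lemma LIMSEQ_componentwise:
  fixes X :: "nat \<Rightarrow> 'a \<Rightarrow> 'b::topological_space"
  shows "X \<longlonglongrightarrow> x \<longleftrightarrow> (\<forall>i. (\<lambda>k. X k i) \<longlonglongrightarrow> x i)"
  using limitin_componentwise[of "\<lambda>i. euclidean" UNIV X x sequentially]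
  by (simp add: euclidean_product_topology)

lemma standard_simplex_ge_0: "x \<in> standard_simplex m \<Longrightarrow> 0 \<le> x i"
  and standard_simplex_sum: "x \<in> standard_simplex m \<Longrightarrow> (\<Sum>i\<le>m. x i) = 1"
  by (simp_all add: standard_simplex_def)

lemma standard_simplexI:
  assumes "\<And>i. 0 \<le> x i" "\<And>i. m < i \<Longrightarrow> x i = 0" "(\<Sum>i\<le>m. x i) = 1"
  shows "x \<in> standard_simplex m"
proof -
  have "x i \<le> 1" for i
  proof (cases "i \<le> m")
    case True
    then have "x i \<le> (\<Sum>i\<le>m. x i)"
      using assms(1) by (intro member_le_sum) auto
    then show ?thesis by (simp add: assms(3))
  qed (simp add: assms(2))
  then show ?thesis using assms by (simp add: standard_simplex_def)
qed

section \<open>Brouwer's fixed point theorem for the cube and the simplex\<close>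

text \<open>The cube \<open>[0,1]^n\<close>, padded with zeros to a sequence, so that it lives in
  the same function space as \<open>standard_simplex\<close> and is compact as a product of compact
  factors.\<close>

definition nat_cube :: "nat \<Rightarrow> (nat \<Rightarrow> real) set" where
  "nat_cube n = PiE UNIV (\<lambda>i. if i < n then {0..1} else {0})"

lemma nat_cube_iff:
  "x \<in> nat_cube n \<longleftrightarrow> (\<forall>i. 0 \<le> x i \<and> x i \<le> 1) \<and> (\<forall>i\<ge>n. x i = 0)"
proof -
  have "x i \<in> (if i < n then {0..1} else {0}) \<longleftrightarrow> (0 \<le> x i \<and> x i \<le> 1) \<and> (n \<le> i \<longrightarrow> x i = 0)" for i
    by auto
  then show ?thesis
    by (auto simp: nat_cube_def PiE_iff)
qed

lemma compact_nat_cube: "compact (nat_cube n)"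
proof -
  have "compactin (product_topology (\<lambda>i. euclidean) UNIV) (nat_cube n)"
    unfolding nat_cube_def compactin_PiE by auto
  then show ?thesis
    by (simp add: euclidean_product_topology)
qed

text \<open>Kuhn's combinatorial lemma supplies, on ever finer grids, a cell which for each
  coordinate has a vertex where \<open>f\<close> does not decrease that coordinate and one where
  \<open>f\<close> does not increase it. A limit point of these cells is fixed.\<close>

lemma brouwer_nat_cube:
  assumes cont: "continuous_on (nat_cube n) f" and maps: "f \<in> nat_cube n \<rightarrow> nat_cube n"
  obtains x where "x \<in> nat_cube n" "f x = x"
proof -
  \<comment> \<open>Grid points of mesh \<open>1 / Suc p\<close>; the successor keeps the number of
    subdivisions positive from \<open>p = 0\<close> on.\<close>
  define pt where "pt p q = (\<lambda>i. if i < n then real (q i) / real (Suc p) else 0)" for p and q :: "nat \<Rightarrow> nat"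
  have pt_in: "pt p q \<in> nat_cube n" if "\<forall>i<n. q i \<le> Suc p" for p q
    using that by (auto simp: pt_def nat_cube_iff divide_le_eq_1)
  \<comment> \<open>Label 0 records that \<open>f\<close> does not decrease coordinate
    \<open>i\<close>. The face \<open>q i = Suc p\<close> gets label 1 by force, as
    \<open>kuhn_lemma\<close> demands; this is harmless because the coordinate is 1 there and
    \<open>f\<close> cannot exceed it.\<close>
  define label where
    "label p q i = (if q i < Suc p \<and> pt p q i \<le> f (pt p q) i then 0 else 1 :: nat)" for p q i
  have fcube: "0 \<le> f (pt p q) i \<and> f (pt p q) i \<le> 1" if "\<forall>i<n. q i \<le> Suc p" for p q i
    using maps pt_in[OF that] by (auto simp: nat_cube_iff Pi_iff)
  have lab0: "pt p q i \<le> f (pt p q) i" if "label p q i = 0" for p q i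
    using that by (auto simp: label_def split: if_splits)
  have lab1: "f (pt p q) i \<le> pt p q i"
    if "label p q i \<noteq> 0" "\<forall>i<n. q i \<le> Suc p" "i < n" for p q i
  proof (cases "q i < Suc p")
    case True
    then show ?thesis using that by (auto simp: label_def split: if_splits)
  next
    case False
    then have "pt p q i = 1"
      using that by (auto simp: pt_def not_less intro: le_antisym)
    then show ?thesis using fcube that by auto
  qed
  define cell where "cell q t \<longleftrightarrow> (\<forall>j<n. q j \<le> t j \<and> t j \<le> q j + 1)" for q t :: "nat \<Rightarrow> nat"
  have "\<exists>q. (\<forall>i<n. q i < Suc p) \<and>
      (\<forall>i<n. \<exists>r s. cell q r \<and> cell q s \<and> label p r i = 0 \<and> label p s i \<noteq> 0)" for p
  proof -
    obtain q where q: "\<forall>i<n. q i < Suc p"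
      and rs: "\<forall>i<n. \<exists>r s. (\<forall>j<n. q j \<le> r j \<and> r j \<le> q j + 1) \<and>
         (\<forall>j<n. q j \<le> s j \<and> s j \<le> q j + 1) \<and> label p r i \<noteq> label p s i"
    proof (rule kuhn_lemma[of "Suc p" n "label p"])
      show "\<forall>x. (\<forall>i<n. x i \<le> Suc p) \<longrightarrow> (\<forall>i<n. x i = 0 \<longrightarrow> label p x i = 0)"
      proof (intro allI impI)
        fix x i assume "\<forall>i<n. x i \<le> Suc p" "i < n" "x i = 0"
        then show "label p x i = 0"
          using fcube[of x p i] by (simp add: label_def pt_def)
      qed
    qed (auto simp: label_def)
    have "\<exists>r s. cell q r \<and> cell q s \<and> label p r i = 0 \<and> label p s i \<noteq> 0" if i: "i < n" for i
    proof -
      obtain r s where 1: "cell q r" "cell q s" "label p r i \<noteq> label p s i"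
        using rs[folded cell_def, rule_format, OF i] by blast
      have "label p r i = 0 \<and> label p s i \<noteq> 0 \<or> label p s i = 0 \<and> label p r i \<noteq> 0"
        using 1(3) by (auto simp: label_def split: if_splits)
      with 1 show ?thesis by blast
    qed
    then show ?thesis using q by blast
  qed
  then have "\<forall>p. \<exists>q. (\<forall>i<n. q i < Suc p) \<and>
      (\<forall>i<n. \<exists>r s. cell q r \<and> cell q s \<and> label p r i = 0 \<and> label p s i \<noteq> 0)" by blast
  from choice[OF this] obtain q where q: "\<And>p i. i < n \<Longrightarrow> q p i < Suc p"
    and rs: "\<And>p i. i < n \<Longrightarrow> \<exists>r s. cell (q p) r \<and> cell (q p) s \<and> label p r i = 0 \<and> label p s i \<noteq> 0"
    by blast
  have "\<forall>p. pt p (q p) \<in> nat_cube n"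
    using q by (intro allI pt_in) (auto intro: less_imp_le)
  then obtain x \<sigma> where x: "x \<in> nat_cube n" and \<sigma>: "strict_mono (\<sigma> :: nat \<Rightarrow> nat)"
    and lim: "((\<lambda>p. pt p (q p)) \<circ> \<sigma>) \<longlonglongrightarrow> x"
    using compact_imp_seq_compact[OF compact_nat_cube, of n] unfolding seq_compact_def by metis
  \<comment> \<open>The cells shrink to the point \<open>x\<close>, so every choice of one vertex
    per cell converges to \<open>x\<close>, and its images converge to \<open>f x\<close>.\<close>
  have near: "(\<lambda>k. f (pt (\<sigma> k) (t (\<sigma> k))) i) \<longlonglongrightarrow> f x i \<and> (\<lambda>k. pt (\<sigma> k) (t (\<sigma> k)) i) \<longlonglongrightarrow> x i"
    if cell: "\<forall>p. cell (q p) (t p)" for t i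
  proof -
    have t: "q p j \<le> t p j \<and> t p j \<le> q p j + 1" if "j < n" for p j
      using cell that by (auto simp: cell_def)
    have "(\<lambda>k. pt (\<sigma> k) (t (\<sigma> k)) j) \<longlonglongrightarrow> x j" for j
    proof (cases "j < n")
      case True
      have inv: "(\<lambda>k. inverse (real (Suc (\<sigma> k)))) \<longlonglongrightarrow> 0"
        using LIMSEQ_subseq_LIMSEQ[OF LIMSEQ_inverse_real_of_nat \<sigma>] by (simp add: o_def)
      have base: "(\<lambda>k. pt (\<sigma> k) (q (\<sigma> k)) j) \<longlonglongrightarrow> x j"
        using lim by (auto simp: LIMSEQ_componentwise o_def)
      \<comment> \<open>A vertex exceeds the lowest corner of its cell by at most one mesh width per
        coordinate, so it is squeezed between two sequences with the same limit.\<close>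
      have up: "(\<lambda>k. pt (\<sigma> k) (q (\<sigma> k)) j + inverse (real (Suc (\<sigma> k)))) \<longlonglongrightarrow> x j"
        using tendsto_add[OF base inv] by simp
      show ?thesis
      proof (rule tendsto_sandwich[OF _ _ base up]; intro always_eventually allI)
        fix k
        show "pt (\<sigma> k) (q (\<sigma> k)) j \<le> pt (\<sigma> k) (t (\<sigma> k)) j"
          using t[OF True] True by (simp add: pt_def divide_right_mono)
        have "real (t (\<sigma> k) j) \<le> real (q (\<sigma> k) j) + 1"
          using t[OF True, of "\<sigma> k"] by linarith
        then have "real (t (\<sigma> k) j) / real (Suc (\<sigma> k)) \<le> (real (q (\<sigma> k) j) + 1) / real (Suc (\<sigma> k))"
          by (rule divide_right_mono) simp
        then show "pt (\<sigma> k) (t (\<sigma> k)) j \<le> pt (\<sigma> k) (q (\<sigma> k)) j + inverse (real (Suc (\<sigma> k)))"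
          using True by (simp add: pt_def inverse_eq_divide add_divide_distrib)
      qed
    next
      case False
      then show ?thesis using x by (simp add: pt_def nat_cube_iff)
    qed
    then have lim': "(\<lambda>k. pt (\<sigma> k) (t (\<sigma> k))) \<longlonglongrightarrow> x"
      by (simp add: LIMSEQ_componentwise)
    have "\<forall>i<n. t p i \<le> Suc p" for p
      using t q by (metis Suc_eq_plus1 Suc_leI le_trans)
    then have "pt p (t p) \<in> nat_cube n" for p
      by (rule pt_in)
    then have "(\<lambda>k. f (pt (\<sigma> k) (t (\<sigma> k)))) \<longlonglongrightarrow> f x"
      using continuous_on_tendsto_compose[OF cont lim' x] by simp
    then show ?thesis using lim' by (simp add: LIMSEQ_componentwise)
  qed
  \<comment> \<open>Vertices with label 0 give one inequality in the limit, those with nonzero label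
    the other. The vertex sequences may depend on \<open>i\<close>, since all have limit
    \<open>x\<close>.\<close>
  have "f x i = x i" for i
  proof (cases "i < n")
    case True
    have "\<forall>p. \<exists>t. cell (q p) t \<and> label p t i = 0"
      using rs[OF True] by blast
    from choice[OF this] obtain r where r: "\<forall>p. cell (q p) (r p)" "\<And>p. label p (r p) i = 0"
      by blast
    have "\<forall>p. \<exists>t. cell (q p) t \<and> label p t i \<noteq> 0"
      using rs[OF True] by blast
    from choice[OF this] obtain s where s: "\<forall>p. cell (q p) (s p)" "\<And>p. label p (s p) i \<noteq> 0"
      by blast
    have sle: "\<forall>j<n. s p j \<le> Suc p" for p
      using s(1) q unfolding cell_def by (metis Suc_eq_plus1 Suc_leI le_trans)
    have "x i \<le> f x i"
      using near[OF r(1), of i] lab0[OF r(2)] by (intro LIMSEQ_le) auto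
    moreover have "f x i \<le> x i"
      using near[OF s(1), of i] lab1[OF s(2) sle True] by (intro LIMSEQ_le) auto
    ultimately show ?thesis by simp
  next
    case False
    then show ?thesis using x maps by (auto simp: nat_cube_iff Pi_iff)
  qed
  then show thesis using that x by blast
qed

text \<open>A fixed point of \<open>f\<close> composed with a retraction onto the simplex is a value
  of \<open>f\<close>, hence lies in the simplex, where the retraction is the identity.\<close>

lemma brouwer_standard_simplex:
  assumes cont: "continuous_on (standard_simplex m) f"
    and maps: "f \<in> standard_simplex m \<rightarrow> standard_simplex m"
  obtains x where "x \<in> standard_simplex m" "f x = x"
proof -
  \<comment> \<open>A retraction of the cube onto the simplex: scale down if the coordinate sum exceeds 1, distribute the defect evenly otherwise.\<close>
  define r where "r x i = (if i \<le> m then (x i + max 0 (1 - (\<Sum>j\<le>m. x j)) / real (Suc m)) /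
      max 1 (\<Sum>j\<le>m. x j) else 0)" for x :: "nat \<Rightarrow> real" and i
  have sub: "standard_simplex m \<subseteq> nat_cube (Suc m)"
    by (auto simp: standard_simplex_def nat_cube_iff)
  have nonneg: "0 \<le> r x i" if "x \<in> nat_cube (Suc m)" for x i
    using that by (auto simp: r_def nat_cube_iff)
  have sum1: "(\<Sum>i\<le>m. r x i) = 1" for x
  proof -
    have "(\<Sum>i\<le>m. r x i) = (\<Sum>i\<le>m. x i + max 0 (1 - (\<Sum>j\<le>m. x j)) / real (Suc m)) / max 1 (\<Sum>j\<le>m. x j)"
      by (simp add: r_def sum_divide_distrib)
    also have "\<dots> = ((\<Sum>i\<le>m. x i) + max 0 (1 - (\<Sum>j\<le>m. x j))) / max 1 (\<Sum>j\<le>m. x j)"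
      by (simp add: sum.distrib)
    \<comment> \<open>Only one correction acts at a time: either the defect is 0 or the divisor is
      1.\<close>
    also have "\<dots> = 1"
      by (simp add: max_def)
    finally show ?thesis .
  qed
  have r_in: "r x \<in> standard_simplex m" if "x \<in> nat_cube (Suc m)" for x
    by (rule standard_simplexI) (use nonneg[OF that] sum1 in \<open>auto simp: r_def\<close>)
  have r_id: "r x = x" if "x \<in> standard_simplex m" for x
    using that by (auto simp: r_def standard_simplex_def)
  have "continuous_on (nat_cube (Suc m)) (\<lambda>x. r x i)" for i
    unfolding r_def by (cases "i \<le> m") (auto intro!: continuous_intros continuous_on_coordinate)
  then have rcont: "continuous_on (nat_cube (Suc m)) r"
    by (rule continuous_on_coordinatewise_then_product)
  have "continuous_on (nat_cube (Suc m)) (f \<circ> r)"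
    by (rule continuous_on_compose[OF rcont continuous_on_subset[OF cont]]) (use r_in in auto)
  moreover have "f \<circ> r \<in> nat_cube (Suc m) \<rightarrow> nat_cube (Suc m)"
    using maps r_in sub by (auto simp: Pi_iff)
  ultimately obtain x where x: "x \<in> nat_cube (Suc m)" "f (r x) = x"
    using brouwer_nat_cube by (metis comp_apply)
  then have "x \<in> standard_simplex m"
    using maps r_in by (metis PiE)
  then show thesis using that x r_id by metis
qed

section \<open>Variational inequalities on the simplex\<close>

text \<open>If \<open>F x\<close> is read as the payoff vector induced by \<open>x\<close>, the
  conclusion says that \<open>x\<close> is a best reply to itself: no vertex earns more than the
  average under \<open>x\<close>.\<close>

lemma variational_inequality_standard_simplex:
  fixes F :: "(nat \<Rightarrow> real) \<Rightarrow> nat \<Rightarrow> real"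
  assumes cont: "\<And>i. i \<le> m \<Longrightarrow> continuous_on (standard_simplex m) (\<lambda>x. F x i)"
  obtains x where "x \<in> standard_simplex m" "\<And>j. j \<le> m \<Longrightarrow> F x j \<le> (\<Sum>i\<le>m. x i * F x i)"
proof -
  \<comment> \<open>Nash's map: its fixed points are the solutions of the variational inequality.\<close>
  define \<phi> where "\<phi> x i = max 0 (F x i - (\<Sum>i\<le>m. x i * F x i))" for x i
  define f where "f x i = (if i \<le> m then (x i + \<phi> x i) / (1 + (\<Sum>j\<le>m. \<phi> x j)) else 0)" for x i
  have \<phi>0: "0 \<le> \<phi> x i" for x i by (simp add: \<phi>_def)
  then have S0: "0 \<le> (\<Sum>j\<le>m. \<phi> x j)" for x by (simp add: sum_nonneg)
  have \<phi>cont: "continuous_on (standard_simplex m) (\<lambda>x. \<phi> x i)" if "i \<le> m" for i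
    unfolding \<phi>_def by (intro continuous_intros continuous_on_coordinate cont that) auto
  have "continuous_on (standard_simplex m) (\<lambda>x. f x i)" for i
  proof (cases "i \<le> m")
    case True
    have "1 + (\<Sum>j\<le>m. \<phi> x j) \<noteq> 0" for x
      using S0[of x] by linarith
    with True show ?thesis
      unfolding f_def by (auto intro!: continuous_intros continuous_on_coordinate \<phi>cont)
  qed (simp add: f_def)
  then have "continuous_on (standard_simplex m) f"
    by (rule continuous_on_coordinatewise_then_product)
  moreover have "f \<in> standard_simplex m \<rightarrow> standard_simplex m"
  proof
    fix x assume x: "x \<in> standard_simplex m"
    have nn: "0 \<le> f x i" for i
      using x \<phi>0 S0[of x] by (auto simp: f_def standard_simplex_def)
    have "(\<Sum>i\<le>m. f x i) = (\<Sum>i\<le>m. x i + \<phi> x i) / (1 + (\<Sum>j\<le>m. \<phi> x j))"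
      by (simp add: f_def sum_divide_distrib)
    then have sum1: "(\<Sum>i\<le>m. f x i) = 1"
      using S0[of x] standard_simplex_sum[OF x] by (simp add: sum.distrib)
    then show "f x \<in> standard_simplex m"
      using nn by (intro standard_simplexI) (auto simp: f_def)
  qed
  ultimately obtain x where x: "x \<in> standard_simplex m" "f x = x"
    by (rule brouwer_standard_simplex)
  define s where "s = (\<Sum>j\<le>m. \<phi> x j)"
  \<comment> \<open>Clearing the denominator in the fixed point equation.\<close>
  have eq: "x i * s = \<phi> x i" if "i \<le> m" for i
  proof -
    have "x i = (x i + \<phi> x i) / (1 + s)"
      using fun_cong[OF x(2), of i] that by (simp add: f_def s_def)
    then show ?thesis using S0[of x] by (simp add: s_def field_simps split: if_splits)
  qed
  define v where "v = (\<Sum>i\<le>m. x i * F x i)"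
  \<comment> \<open>If \<open>s\<close> were positive, every coordinate of positive weight would
    have a payoff strictly above the average \<open>v\<close>, although the weighted deviations from
    \<open>v\<close> sum to 0.\<close>
  have "s = 0"
  proof (rule ccontr)
    assume "s \<noteq> 0"
    then have s: "s > 0" using S0[of x] by (simp add: s_def)
    have "(\<Sum>i\<le>m. x i * (F x i - v)) = v - (\<Sum>i\<le>m. x i) * v"
      by (simp add: right_diff_distrib sum_subtractf v_def sum_distrib_right)
    then have z: "(\<Sum>i\<le>m. x i * (F x i - v)) = 0"
      using standard_simplex_sum[OF x(1)] by simp
    have pos: "0 < F x i - v" if "i \<le> m" "0 < x i" for i
    proof -
      have "0 < \<phi> x i" using eq[OF that(1)] that s by (metis mult_pos_pos)
      then show ?thesis by (simp add: \<phi>_def v_def)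
    qed
    have nn: "0 \<le> x i * (F x i - v)" if "i \<le> m" for i
      using pos[OF that] standard_simplex_ge_0[OF x(1), of i]
      by (cases "x i = 0") (auto intro!: mult_nonneg_nonneg simp: less_le)
    obtain i where i: "i \<le> m" "x i \<noteq> 0"
      using standard_simplex_sum[OF x(1)] by (metis atMost_iff sum.neutral zero_neq_one)
    then have "0 < x i" using standard_simplex_ge_0[OF x(1), of i] by simp
    moreover have "x i * (F x i - v) = 0"
      using z nn i by (subst (asm) sum_nonneg_eq_0_iff) auto
    ultimately show False using pos[of i] i by auto
  qed
  then have "\<phi> x j = 0" if "j \<le> m" for j
    using eq[OF that] by simp
  then have "F x j \<le> (\<Sum>i\<le>m. x i * F x i)" if "j \<le> m" for j
    using that by (fastforce simp: \<phi>_def max_def split: if_splits)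
  then show thesis using that x by blast
qed

section \<open>Caratheodory reduction of weights\<close>

text \<open>Gaussian elimination, by induction on the number of equations: the last equation is
  either trivial or solved for one unknown.\<close>

lemma underdetermined_system_nontrivial_solution:
  fixes a :: "nat \<Rightarrow> 'b \<Rightarrow> 'c::field"
  assumes "finite S" "n < card S"
  shows "\<exists>c. (\<exists>x\<in>S. c x \<noteq> 0) \<and> (\<forall>i<n. (\<Sum>x\<in>S. c x * a i x) = 0)"
  using assms
proof (induction n arbitrary: S a)
  case 0
  then have "S \<noteq> {}" by auto
  then show ?case by (intro exI[of _ "\<lambda>_. 1"]) auto
next
  case (Suc n)
  show ?case
  proof (cases "\<forall>x\<in>S. a n x = 0")
    case True
    obtain c where "\<exists>x\<in>S. c x \<noteq> 0" "\<forall>i<n. (\<Sum>x\<in>S. c x * a i x) = 0"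
      using Suc.IH[of S a] Suc.prems by auto
    with True show ?thesis by (auto simp: less_Suc_eq intro!: exI[of _ c])
  next
    case False
    then obtain s where s: "s \<in> S" "a n s \<noteq> 0" by blast
    \<comment> \<open>The coefficients left after eliminating the unknown at \<open>s\<close> by
      means of equation \<open>n\<close>.\<close>
    define b where "b i x = a i x - a i s * a n x / a n s" for i x
    have "n < card (S - {s})" using Suc.prems s by simp
    then obtain c where c: "\<exists>x\<in>S - {s}. c x \<noteq> 0" "\<forall>i<n. (\<Sum>x\<in>S - {s}. c x * b i x) = 0"
      using Suc.IH[of "S - {s}" b] Suc.prems by auto
    \<comment> \<open>The value at \<open>s\<close> is the one that equation \<open>n\<close>
      forces.\<close>
    define d where "d = c(s := - (\<Sum>x\<in>S - {s}. c x * a n x) / a n s)"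
    have expand: "(\<Sum>x\<in>S. d x * a i x) = (\<Sum>x\<in>S - {s}. c x * b i x)" for i
    proof -
      have "(\<Sum>x\<in>S. d x * a i x) = d s * a i s + (\<Sum>x\<in>S - {s}. d x * a i x)"
        using s Suc.prems by (simp add: sum.remove)
      also have "(\<Sum>x\<in>S - {s}. d x * a i x) = (\<Sum>x\<in>S - {s}. c x * a i x)"
        by (rule sum.cong) (auto simp: d_def)
      also have "d s * a i s = - (\<Sum>x\<in>S - {s}. c x * (a i s * a n x / a n s))"
        by (simp add: d_def sum_divide_distrib sum_distrib_left sum_distrib_right ac_simps)
      finally show ?thesis
        by (simp add: b_def right_diff_distrib sum_subtractf)
    qed
    have "b n x = 0" for x using s by (simp add: b_def)
    then have "\<forall>i<Suc n. (\<Sum>x\<in>S. d x * a i x) = 0"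
      using c(2) by (auto simp: expand less_Suc_eq)
    moreover have "\<exists>x\<in>S. d x \<noteq> 0"
      using c(1) by (auto simp: d_def)
    ultimately show ?thesis by blast
  qed
qed

text \<open>As long as more than \<open>n\<close> weights are positive, a linear relation between
  their vectors allows a shift that preserves all \<open>n\<close> sums and makes a weight vanish.
  Keeping \<open>S'\<close> among the points of positive weight ensures later that the atoms remain
  near-minimizers.\<close>

lemma conic_caratheodory_functions:
  fixes a :: "nat \<Rightarrow> 'b \<Rightarrow> real"
  assumes "finite S" "\<And>x. x \<in> S \<Longrightarrow> 0 \<le> p x"
  shows "\<exists>S' q. S' \<subseteq> {x \<in> S. 0 < p x} \<and> card S' \<le> n \<and> (\<forall>x\<in>S'. 0 \<le> q x) \<and>
    (\<forall>i<n. (\<Sum>x\<in>S'. q x * a i x) = (\<Sum>x\<in>S. p x * a i x))"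
  using assms
proof (induction "card {x \<in> S. 0 < p x}" arbitrary: p rule: less_induct)
  case less
  define P where "P = {x \<in> S. 0 < p x}"
  have P: "finite P" "P \<subseteq> S" and Ppos: "\<And>x. x \<in> P \<Longrightarrow> 0 < p x"
    using less.prems by (auto simp: P_def)
  have onP: "(\<Sum>x\<in>P. p x * a i x) = (\<Sum>x\<in>S. p x * a i x)" for i
    using less.prems by (intro sum.mono_neutral_left) (auto simp: P_def less_le)
  show ?case
  proof (cases "card P \<le> n")
    case True
    have "\<forall>x\<in>P. 0 \<le> p x" using Ppos by (simp add: less_imp_le)
    moreover have "\<forall>i<n. (\<Sum>x\<in>P. p x * a i x) = (\<Sum>x\<in>S. p x * a i x)"
      using onP by simp
    ultimately show ?thesis
      using True unfolding P_def by (intro exI[of _ "{x \<in> S. 0 < p x}"] exI[of _ p] conjI subset_refl)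
  next
    case False
    then obtain c0 where c0: "\<exists>x\<in>P. c0 x \<noteq> 0" "\<forall>i<n. (\<Sum>x\<in>P. c0 x * a i x) = 0"
      using underdetermined_system_nontrivial_solution[OF P(1), of n a] by (meson not_less)
    \<comment> \<open>After a change of sign if necessary, the relation has a positive coefficient,
      which bounds the step along it.\<close>
    obtain c where cpos: "\<exists>x\<in>P. c x > 0" and c: "\<forall>i<n. (\<Sum>x\<in>P. c x * a i x) = 0"
    proof (cases "\<exists>x\<in>P. c0 x > 0")
      case True then show ?thesis using that c0 by blast
    next
      case False
      then have "\<exists>x\<in>P. - c0 x > 0"
        using c0(1) by (metis neg_0_less_iff_less linorder_neqE_linordered_idom)
      then show ?thesis
        using c0(2) by (intro that[of "\<lambda>x. - c0 x"]) (simp_all add: sum_negf)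
    qed
    define Q where "Q = {x \<in> P. c x > 0}"
    have Q: "finite Q" "Q \<noteq> {}" using P cpos by (auto simp: Q_def)
    \<comment> \<open>The largest step along the relation that keeps all weights nonnegative.\<close>
    obtain z where z: "z \<in> Q" "\<And>x. x \<in> Q \<Longrightarrow> p z / c z \<le> p x / c x"
      using ex_is_arg_min_if_finite[OF Q, of "\<lambda>x. p x / c x"] unfolding is_arg_min_linorder by blast
    define t where "t = p z / c z"
    have zP: "z \<in> P" "c z > 0" using z by (auto simp: Q_def)
    then have "t > 0" using Ppos by (simp add: t_def)
    \<comment> \<open>On \<open>Q\<close> the choice of \<open>t\<close> keeps the weights
      nonnegative, on the rest of \<open>P\<close> they do not decrease, and \<open>z\<close> drops
      to weight 0.\<close>
    define p' where "p' x = (if x \<in> P then p x - t * c x else 0)" for x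
    have nn: "0 \<le> p' x" for x
    proof (cases "x \<in> Q")
      case True
      then have "t \<le> p x / c x" "c x > 0" using z by (auto simp: t_def Q_def)
      then show ?thesis by (simp add: p'_def pos_le_divide_eq)
    next
      case False
      then have "x \<in> P \<Longrightarrow> t * c x \<le> 0"
        using \<open>t > 0\<close> by (auto simp: Q_def mult_le_0_iff not_less)
      then show ?thesis using Ppos[of x] by (auto simp: p'_def)
    qed
    have "z \<notin> {x \<in> S. 0 < p' x}" using zP by (simp add: p'_def t_def)
    moreover have sub: "{x \<in> S. 0 < p' x} \<subseteq> P" by (auto simp: p'_def split: if_splits)
    ultimately have "card {x \<in> S. 0 < p' x} < card P"
      using zP P by (intro psubset_card_mono) auto
    from less.hyps[OF this[unfolded P_def] less.prems(1) nn] obtain S' q where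
      S': "S' \<subseteq> {x \<in> S. 0 < p' x}" "card S' \<le> n" "\<forall>x\<in>S'. 0 \<le> q x"
      "\<forall>i<n. (\<Sum>x\<in>S'. q x * a i x) = (\<Sum>x\<in>S. p' x * a i x)"
      by (elim exE conjE)
    have "(\<Sum>x\<in>S. p' x * a i x) = (\<Sum>x\<in>S. p x * a i x)" if "i < n" for i
    proof -
      have "(\<Sum>x\<in>S. p' x * a i x) = (\<Sum>x\<in>P. p' x * a i x)"
        using P less.prems by (intro sum.mono_neutral_right) (auto simp: p'_def)
      also have "\<dots> = (\<Sum>x\<in>P. p x * a i x) - t * (\<Sum>x\<in>P. c x * a i x)"
        by (simp add: p'_def left_diff_distrib sum_subtractf sum_distrib_left mult.assoc)
      finally show ?thesis using c that onP by simp
    qed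
    then have "\<forall>i<n. (\<Sum>x\<in>S'. q x * a i x) = (\<Sum>x\<in>S. p x * a i x)"
      using S'(4) by simp
    moreover have "S' \<subseteq> P" using S'(1) sub by (rule subset_trans)
    ultimately show ?thesis using S'(2,3) unfolding P_def
      by (intro exI[of _ S'] exI[of _ q] conjI)
  qed
qed

section \<open>Approximate equilibria on finite sets\<close>

lemma finite_approximate_equilibrium:
  fixes L :: "'a \<Rightarrow> (nat \<Rightarrow> real) \<Rightarrow> real" and G :: "nat \<Rightarrow> 'a \<Rightarrow> real"
  assumes S: "finite S" "S \<noteq> {}" and "0 < \<epsilon>"
    and L: "\<And>x. x \<in> S \<Longrightarrow> continuous_on (standard_simplex m) (L x)"
    and G0: "\<And>x. G 0 x = 0"
  obtains l \<mu> x where "l \<in> standard_simplex m" "\<mu> \<in> standard_simplex m" "\<And>k. x k \<in> S"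
    "\<And>y. y \<in> S \<Longrightarrow> (\<Sum>k\<le>m. \<mu> k * L (x k) l) \<le> L y l + \<epsilon>"
    "\<And>j. j \<le> m \<Longrightarrow> (\<Sum>k\<le>m. \<mu> k * G j (x k)) \<le> (\<Sum>i\<le>m. l i * (\<Sum>k\<le>m. \<mu> k * G i (x k)))"
proof -
  \<comment> \<open>Continuous in \<open>l\<close>, and positive exactly at the points within less than \<open>\<epsilon>\<close> of the minimum of \<open>L\<close> over \<open>S\<close>.\<close>
  define w where "w l x = (\<Prod>y\<in>S. max 0 (\<epsilon> + L y l - L x l))" for l x
  \<comment> \<open>The weights are left unnormalized: the variational inequality is homogeneous in
    \<open>F\<close>, so division by the total \<open>W\<close> can wait until the end.\<close>
  define F where "F l i = (\<Sum>x\<in>S. w l x * G i x)" for l i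
  have "continuous_on (standard_simplex m) (\<lambda>l. F l i)" for i
    unfolding F_def w_def by (intro continuous_intros L)
  then obtain l where l: "l \<in> standard_simplex m"
    and vi: "\<And>j. j \<le> m \<Longrightarrow> F l j \<le> (\<Sum>i\<le>m. l i * F l i)"
    using variational_inequality_standard_simplex[of m F] by blast
  have w0: "0 \<le> w l x" for x by (simp add: w_def prod_nonneg)
  have wpos: "L x l \<le> L y l + \<epsilon>" if "0 < w l x" "y \<in> S" for x y
  proof (rule ccontr)
    assume "\<not> L x l \<le> L y l + \<epsilon>"
    then have "max 0 (\<epsilon> + L y l - L x l) = 0" by simp
    then have "w l x = 0" using S that(2) by (auto simp: w_def intro!: prod_zero)
    then show False using that by simp
  qed
  obtain z where z: "z \<in> S" "\<And>y. y \<in> S \<Longrightarrow> L z l \<le> L y l"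
    using ex_is_arg_min_if_finite[OF S, of "\<lambda>x. L x l"] unfolding is_arg_min_linorder by blast
  \<comment> \<open>At an exact minimizer every factor is at least \<epsilon>, so the total weight
    is positive.\<close>
  have "0 < w l z"
    unfolding w_def using z(2) \<open>0 < \<epsilon>\<close> by (intro prod_pos) (fastforce simp: less_max_iff_disj)
  define W where "W = (\<Sum>x\<in>S. w l x)"
  have "w l z \<le> W" unfolding W_def using S z w0 by (intro member_le_sum) auto
  then have W: "0 < W" using \<open>0 < w l z\<close> by simp
  \<comment> \<open>Since \<open>G 0\<close> vanishes, index 0 is free to preserve the total mass.
    Mass and the \<open>m\<close> constraint payoffs are then \<open>m + 1\<close> functionals,
    which yields \<open>m + 1\<close> atoms instead of \<open>m + 2\<close>.\<close>
  define a where "a i = (if i = 0 then (\<lambda>_. 1) else G i)" for i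
  obtain S' q where S': "S' \<subseteq> {x \<in> S. 0 < w l x}" "card S' \<le> Suc m" and q: "\<forall>x\<in>S'. 0 \<le> q x"
    and qa: "\<forall>i<Suc m. (\<Sum>x\<in>S'. q x * a i x) = (\<Sum>x\<in>S. w l x * a i x)"
    using conic_caratheodory_functions[where p = "w l" and n = "Suc m" and a = a, OF S(1) w0] by (elim exE conjE)
  have qW: "(\<Sum>x\<in>S'. q x) = W"
    using qa[rule_format, of 0] by (simp add: a_def W_def)
  have qF: "(\<Sum>x\<in>S'. q x * G i x) = F l i" if "i \<le> m" for i
    using qa[rule_format, of i] that by (cases "i = 0") (simp_all add: a_def F_def G0)
  have "finite S'" using S' S(1) by (auto intro: finite_subset)
  then obtain h where h: "bij_betw h {0..<card S'} S'"
    using ex_bij_betw_nat_finite by blast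
  then have hS: "h k \<in> S'" if "k < card S'" for k
    using that by (auto simp: bij_betw_def)
  define x where "x k = (if k < card S' then h k else z)" for k
  define \<mu> where "\<mu> k = (if k < card S' then q (h k) / W else 0)" for k
  have transfer: "(\<Sum>k\<le>m. \<mu> k * u (x k)) = (\<Sum>s\<in>S'. q s * u s) / W" for u
  proof -
    have "(\<Sum>k\<le>m. \<mu> k * u (x k)) = (\<Sum>k\<in>{0..<card S'}. \<mu> k * u (x k))"
      using S'(2) by (intro sum.mono_neutral_right) (auto simp: \<mu>_def)
    also have "\<dots> = (\<Sum>k\<in>{0..<card S'}. q (h k) * u (h k) / W)"
      by (rule sum.cong) (auto simp: \<mu>_def x_def)
    also have "\<dots> = (\<Sum>s\<in>S'. q s * u s / W)"
      by (rule sum.reindex_bij_betw[OF h, of "\<lambda>s. q s * u s / W"])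
    finally show ?thesis by (simp add: sum_divide_distrib)
  qed
  show thesis
  proof (rule that[of l \<mu> x])
    show "\<mu> \<in> standard_simplex m"
    proof (rule standard_simplexI)
      show "0 \<le> \<mu> k" for k using q hS W by (simp add: \<mu>_def)
      show "\<mu> k = 0" if "m < k" for k using that S'(2) by (simp add: \<mu>_def)
      show "(\<Sum>k\<le>m. \<mu> k) = 1" using transfer[of "\<lambda>_. 1"] qW W by simp
    qed
    show "x k \<in> S" for k using hS S' z by (auto simp: x_def)
    show "(\<Sum>k\<le>m. \<mu> k * L (x k) l) \<le> L y l + \<epsilon>" if "y \<in> S" for y
    proof -
      have "(\<Sum>s\<in>S'. q s * L s l) \<le> (\<Sum>s\<in>S'. q s * (L y l + \<epsilon>))"
        using q S' wpos[OF _ that] by (intro sum_mono mult_left_mono) auto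
      also have "\<dots> = W * (L y l + \<epsilon>)" by (simp add: qW flip: sum_distrib_right)
      finally show ?thesis using W by (simp add: transfer[of "\<lambda>s. L s l"] field_simps)
    qed
    show "(\<Sum>k\<le>m. \<mu> k * G j (x k)) \<le> (\<Sum>i\<le>m. l i * (\<Sum>k\<le>m. \<mu> k * G i (x k)))" if "j \<le> m" for j
    proof -
      have "(\<Sum>i\<le>m. l i * (\<Sum>k\<le>m. \<mu> k * G i (x k))) = (\<Sum>i\<le>m. l i * F l i) / W"
        unfolding sum_divide_distrib by (rule sum.cong) (simp_all add: transfer qF)
      then show ?thesis
        using vi[OF that] W that by (simp add: transfer qF divide_right_mono)
    qed
  qed (rule l)
qed

section \<open>Passage to the limit by compactness\<close>

lemma closedin_continuous_map_le:
  assumes "continuous_map X euclideanreal f" "continuous_map X euclideanreal h"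
  shows "closedin X {x \<in> topspace X. f x \<le> h x}"
proof -
  have "closedin X {x \<in> topspace X. f x - h x \<in> {..0}}"
    by (rule closedin_continuous_map_preimage[where Y = euclideanreal])
       (auto intro: continuous_map_diff assms)
  then show ?thesis by simp
qed

lemma compact_mixed_equilibrium:
  fixes T :: "'a topology" and L :: "'a \<Rightarrow> (nat \<Rightarrow> real) \<Rightarrow> real" and G :: "nat \<Rightarrow> 'a \<Rightarrow> real"
  assumes T: "topspace T \<noteq> {}" "compact_space T"
    and L: "continuous_map (prod_topology T (top_of_set (standard_simplex m))) euclideanreal (\<lambda>(x, l). L x l)"
    and G: "\<And>i. i \<le> m \<Longrightarrow> continuous_map T euclideanreal (G i)"
    and G0: "\<And>x. G 0 x = 0"
  obtains l \<mu> x where "l \<in> standard_simplex m" "\<mu> \<in> standard_simplex m"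
    "\<And>k. k \<le> m \<Longrightarrow> x k \<in> topspace T"
    "\<And>y. y \<in> topspace T \<Longrightarrow> (\<Sum>k\<le>m. \<mu> k * L (x k) l) \<le> L y l"
    "\<And>j. j \<le> m \<Longrightarrow> (\<Sum>k\<le>m. \<mu> k * G j (x k)) \<le> (\<Sum>i\<le>m. l i * (\<Sum>k\<le>m. \<mu> k * G i (x k)))"
proof -
  define D where "D = top_of_set (standard_simplex m)"
  \<comment> \<open>The bound on the number of atoms is what makes this one fixed space; it is
    compact by Tychonoff's theorem.\<close>
  define Z where "Z = prod_topology (prod_topology D D) (product_topology (\<lambda>_. T) {..m})"
  define EL where "EL z = (\<Sum>k\<le>m. snd (fst z) k * L (snd z k) (fst (fst z)))" for z
  define V where "V j z = (\<Sum>k\<le>m. snd (fst z) k * G j (snd z k))"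
    for j and z :: "((nat \<Rightarrow> real) \<times> (nat \<Rightarrow> real)) \<times> (nat \<Rightarrow> 'a)"
  define VI where "VI = {z \<in> topspace Z. \<forall>j\<in>{..m}. V j z \<le> (\<Sum>i\<le>m. fst (fst z) i * V i z)}"
  \<comment> \<open>Each set tests a single deviation \<open>y\<close> up to \<epsilon>. The
    condition of the \<lambda>-player is imposed exactly, since the approximate equilibria satisfy
    it exactly.\<close>
  define C where "C y \<epsilon> = {z \<in> topspace Z. EL z \<le> L y (fst (fst z)) + \<epsilon>} \<inter> VI" for y \<epsilon>
  have topZ: "((l, \<mu>), x) \<in> topspace Z \<longleftrightarrow>
      l \<in> standard_simplex m \<and> \<mu> \<in> standard_simplex m \<and> x \<in> {..m} \<rightarrow>\<^sub>E topspace T" for l \<mu> x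
    by (simp add: Z_def D_def)
  have "compactin euclidean (standard_simplex m)"
    using compactin_standard_simplex[of m] by (simp add: euclidean_product_topology)
  then have "compact_space D"
    unfolding D_def by (rule compact_space_subtopology)
  then have compactZ: "compact_space Z"
    using T by (simp add: Z_def compact_space_prod_topology compact_space_product_topology)
  have c1: "continuous_map Z D (\<lambda>z. fst (fst z))" and c2: "continuous_map Z D (\<lambda>z. snd (fst z))"
    using continuous_map_compose[OF continuous_map_fst continuous_map_fst]
      continuous_map_compose[OF continuous_map_fst continuous_map_snd]
    by (simp_all add: Z_def o_def)
  have Dcoord: "continuous_map D euclideanreal (\<lambda>l. l i)" for i
    unfolding D_def continuous_map_iff_continuous by (rule continuous_on_coordinate)
  have c1i: "continuous_map Z euclideanreal (\<lambda>z. fst (fst z) i)"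
    and c2i: "continuous_map Z euclideanreal (\<lambda>z. snd (fst z) i)" for i
    using continuous_map_compose[OF c1 Dcoord] continuous_map_compose[OF c2 Dcoord]
    by (simp_all add: o_def)
  have cx: "continuous_map Z T (\<lambda>z. snd z k)" if "k \<le> m" for k
    unfolding Z_def using that continuous_map_compose[OF continuous_map_snd
      continuous_map_product_coordinates[of k "{..m}" "\<lambda>_. T"]] by (simp add: o_def)
  have cL: "continuous_map Z euclideanreal (\<lambda>z. L (t z) (fst (fst z)))" if "continuous_map Z T t" for t
  proof -
    have "continuous_map Z (prod_topology T D) (\<lambda>z. (t z, fst (fst z)))"
      using that c1 by (simp add: continuous_map_pairedI)
    from continuous_map_compose[OF this L[folded D_def]] show ?thesis by (simp add: o_def)
  qed
  have cG: "continuous_map Z euclideanreal (\<lambda>z. G j (snd z k))" if "j \<le> m" "k \<le> m" for j k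
    using continuous_map_compose[OF cx[OF that(2)] G[OF that(1)]] by (simp add: o_def)
  have cEL: "continuous_map Z euclideanreal EL"
    unfolding EL_def by (intro continuous_map_sum continuous_map_real_mult c2i cL cx) auto
  have cV: "continuous_map Z euclideanreal (V j)" if "j \<le> m" for j
    unfolding V_def using that by (intro continuous_map_sum continuous_map_real_mult c2i cG) auto
  have "VI = (\<Inter>j\<in>{..m}. {z \<in> topspace Z. V j z \<le> (\<Sum>i\<le>m. fst (fst z) i * V i z)})"
    unfolding VI_def by auto
  moreover have "closedin Z (\<Inter>j\<in>{..m}. {z \<in> topspace Z. V j z \<le> (\<Sum>i\<le>m. fst (fst z) i * V i z)})"
    by (intro closedin_INT closedin_continuous_map_le cV continuous_map_sum continuous_map_real_mult c1i) auto
  ultimately have closedVI: "closedin Z VI" by simp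
  have closedC: "closedin Z (C y \<epsilon>)" if "y \<in> topspace T" for y \<epsilon>
    unfolding C_def
    using that by (intro closedin_Int closedVI closedin_continuous_map_le cEL continuous_map_add cL) auto
  define \<U> where "\<U> = (\<lambda>(y, \<epsilon>). C y \<epsilon>) ` (topspace T \<times> {0<..})"
  \<comment> \<open>Finitely many sets involve finitely many deviations; an approximate equilibrium
    on these, with the smallest tolerance that occurs, lies in all of them.\<close>
  have fip: "\<Inter>\<F> \<noteq> {}" if \<F>: "finite \<F>" "\<F> \<subseteq> \<U>" for \<F>
  proof (cases "\<F> = {}")
    case False
    obtain P where P: "P \<subseteq> topspace T \<times> {0<..}" "finite P" "\<F> = (\<lambda>(y, \<epsilon>). C y \<epsilon>) ` P"
      using finite_subset_image[OF \<F>[unfolded \<U>_def]] by metis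
    with False have "P \<noteq> {}" by auto
    define S where "S = fst ` P"
    define \<epsilon> where "\<epsilon> = Min (snd ` P)"
    have "\<epsilon> \<in> snd ` P" using P \<open>P \<noteq> {}\<close> by (auto simp: \<epsilon>_def)
    then have "0 < \<epsilon>" using P(1) by auto
    have S: "finite S" "S \<noteq> {}" "S \<subseteq> topspace T" using P \<open>P \<noteq> {}\<close> by (auto simp: S_def)
    have LS: "continuous_on (standard_simplex m) (L y)" if "y \<in> S" for y
    proof -
      have "continuous_map D (prod_topology T D) (\<lambda>l. (y, l))"
        using that S by (auto simp: continuous_map_pairedI)
      from continuous_map_compose[OF this L[folded D_def]]
      show ?thesis by (simp add: o_def D_def)
    qed
    obtain l \<mu> x where e: "l \<in> standard_simplex m" "\<mu> \<in> standard_simplex m" "\<And>k. x k \<in> S"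
      "\<And>y. y \<in> S \<Longrightarrow> (\<Sum>k\<le>m. \<mu> k * L (x k) l) \<le> L y l + \<epsilon>"
      "\<And>j. j \<le> m \<Longrightarrow> (\<Sum>k\<le>m. \<mu> k * G j (x k)) \<le> (\<Sum>i\<le>m. l i * (\<Sum>k\<le>m. \<mu> k * G i (x k)))"
      using finite_approximate_equilibrium[of S \<epsilon> m L G, OF S(1,2) \<open>0 < \<epsilon>\<close> LS G0] by blast
    \<comment> \<open>Points of the product topology over \<open>{..m}\<close> are undefined outside
      the index set, hence the restriction.\<close>
    define z where "z = ((l, \<mu>), restrict x {..m})"
    have zZ: "z \<in> topspace Z"
      using e(1-3) S(3) by (auto simp: z_def topZ)
    have ELz: "EL z = (\<Sum>k\<le>m. \<mu> k * L (x k) l)" and Vz: "V j z = (\<Sum>k\<le>m. \<mu> k * G j (x k))" for j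
      by (auto simp: z_def EL_def V_def)
    have "z \<in> VI"
      using e(5) zZ by (simp add: VI_def Vz) (simp add: z_def)
    have "z \<in> C y \<delta>" if "(y, \<delta>) \<in> P" for y \<delta>
    proof -
      have "\<epsilon> \<le> \<delta>" unfolding \<epsilon>_def using P that by (intro Min_le) force+
      moreover have "y \<in> S" using that by (force simp: S_def)
      ultimately have "EL z \<le> L y (fst (fst z)) + \<delta>"
        using e(4)[of y] unfolding ELz by (simp add: z_def)
      then show ?thesis using zZ \<open>z \<in> VI\<close> by (simp add: C_def)
    qed
    then have "z \<in> \<Inter>\<F>" using P(3) by auto
    then show ?thesis by blast
  qed auto
  have "\<forall>C\<in>\<U>. closedin Z C" using closedC by (auto simp: \<U>_def)
  with fip have "\<Inter>\<U> \<noteq> {}"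
    by (intro compactZ[unfolded compact_space_fip, rule_format, of \<U>]) simp
  then obtain z where "z \<in> \<Inter>\<U>" by blast
  then have z: "z \<in> C y \<epsilon>" if "y \<in> topspace T" "0 < \<epsilon>" for y \<epsilon>
    using that by (auto simp: \<U>_def)
  obtain l \<mu> x where zeq: "z = ((l, \<mu>), x)" by (metis prod.collapse)
  \<comment> \<open>Any one set of the family already yields membership in \<open>Z\<close> and
    \<open>VI\<close>.\<close>
  obtain y0 where "y0 \<in> topspace T" using T by blast
  then have "z \<in> C y0 1" by (rule z) simp
  then have zZ: "z \<in> topspace Z" and zVI: "z \<in> VI" by (auto simp: C_def)
  show thesis
  proof (rule that[of l \<mu> x])
    show "l \<in> standard_simplex m" "\<mu> \<in> standard_simplex m"
      using zZ by (auto simp: zeq topZ)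
    show "x k \<in> topspace T" if "k \<le> m" for k
      using zZ that by (auto simp: zeq topZ)
    show "(\<Sum>k\<le>m. \<mu> k * L (x k) l) \<le> L y l" if "y \<in> topspace T" for y
    proof (rule field_le_epsilon)
      fix \<epsilon> :: real assume "0 < \<epsilon>"
      then have "z \<in> C y \<epsilon>" by (rule z[OF that])
      then show "(\<Sum>k\<le>m. \<mu> k * L (x k) l) \<le> L y l + \<epsilon>"
        by (simp add: C_def EL_def zeq)
    qed
    show "(\<Sum>k\<le>m. \<mu> k * G j (x k)) \<le> (\<Sum>i\<le>m. l i * (\<Sum>k\<le>m. \<mu> k * G i (x k)))" if "j \<le> m" for j
      using zVI that by (simp add: VI_def V_def zeq)
  qed
qed

section \<open>From weighted atoms to a random variable\<close>

theorem lemma5: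
  fixes T :: "'a topology" and m :: nat and g gt :: "nat \<Rightarrow> 'a \<Rightarrow> real"
  assumes "topspace T \<noteq> {}" and "compact_space T" and "Hausdorff_space T"
    and "\<And>i. i \<in> {0..m} \<Longrightarrow> continuous_map T euclideanreal (g i)"
    and "\<And>i. i \<in> {1..m} \<Longrightarrow> continuous_map T euclideanreal (gt i)"
    and "\<And>i x. i \<in> {1..m} \<Longrightarrow> x \<in> topspace T \<Longrightarrow> g i x \<le> gt i x"
  shows "\<exists>(M :: nat measure) (X :: nat \<Rightarrow> 'a) (l :: nat \<Rightarrow> real).
    mixed_nash T m g gt M X l \<and> supported_on_at_most T M X (m + 1)"
proof -
  define L where "L = lagr_theta m g gt"
  \<comment> \<open>The \<lambda>-player earns nothing from the weight on the objective, so the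
    payoff of vertex 0 is 0.\<close>
  define G where "G = g(0 := (\<lambda>_. 0))"
  let ?Y = "prod_topology T (top_of_set (standard_simplex m))"
  have coord: "continuous_map ?Y euclideanreal (\<lambda>p. snd p i)" for i
  proof -
    have "continuous_map (top_of_set (standard_simplex m)) euclideanreal (\<lambda>l. l i)"
      unfolding continuous_map_iff_continuous by (rule continuous_on_coordinate)
    from continuous_map_compose[OF continuous_map_snd this] show ?thesis by (simp add: o_def)
  qed
  have fst: "continuous_map ?Y euclideanreal (\<lambda>p. f (fst p))"
    if "continuous_map T euclideanreal f" for f :: "'a \<Rightarrow> real"
    using continuous_map_compose[OF continuous_map_fst that] by (simp add: o_def)
  have "continuous_map ?Y euclideanreal (\<lambda>(x, l). L x l)"
    unfolding L_def lagr_theta_def case_prod_unfold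
    by (intro continuous_map_add continuous_map_sum continuous_map_real_mult coord fst assms) auto
  moreover have "continuous_map T euclideanreal (G i)" if "i \<le> m" for i
    using that assms(4)[of i] by (auto simp: G_def)
  moreover have "G 0 x = 0" for x by (simp add: G_def)
  ultimately obtain l \<mu> x where l: "l \<in> standard_simplex m" and \<mu>: "\<mu> \<in> standard_simplex m"
    and x: "\<And>k. k \<le> m \<Longrightarrow> x k \<in> topspace T"
    and min: "\<And>y. y \<in> topspace T \<Longrightarrow> (\<Sum>k\<le>m. \<mu> k * L (x k) l) \<le> L y l"
    and vi: "\<And>j. j \<le> m \<Longrightarrow> (\<Sum>k\<le>m. \<mu> k * G j (x k)) \<le> (\<Sum>i\<le>m. l i * (\<Sum>k\<le>m. \<mu> k * G i (x k)))"
    using compact_mixed_equilibrium[OF assms(1,2), of m L G] by blast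
  have \<mu>0: "0 \<le> \<mu> k" for k using standard_simplex_ge_0[OF \<mu>] .
  have \<mu>gt: "\<mu> k = 0" if "k > m" for k using \<mu> that by (simp add: standard_simplex_def)
  have sum_eq: "(\<integral>\<^sup>+k. ennreal (\<mu> k) \<partial>count_space UNIV) = 1"
  proof -
    have "(\<integral>\<^sup>+k. ennreal (\<mu> k) \<partial>count_space UNIV) = (\<Sum>k\<le>m. ennreal (\<mu> k))"
      using \<mu>gt by (intro nn_integral_count_space') (auto simp: not_le)
    also have "\<dots> = 1"
      using \<mu>0 standard_simplex_sum[OF \<mu>] by (simp add: sum_ennreal)
    finally show ?thesis .
  qed
  \<comment> \<open>The sample space is the set of indices of the atoms, so repeated atoms need no
    merging.\<close>
  define M where "M = embed_pmf \<mu>"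
  have pmfM: "pmf M k = \<mu> k" for k
    unfolding M_def by (rule pmf_embed_pmf[OF \<mu>0 sum_eq])
  have setM: "set_pmf M \<subseteq> {..m}"
    using \<mu>gt by (auto simp: set_pmf_eq pmfM not_le[symmetric])
  \<comment> \<open>The default \<open>x 0\<close> at null indices keeps all values of
    \<open>X\<close> in the space, as measurability requires.\<close>
  define X where "X k = (if k \<le> m then x k else x 0)" for k
  have X: "X k \<in> topspace T" for k using x by (simp add: X_def)
  have E: "(\<integral>k. u (X k) \<partial>M) = (\<Sum>k\<le>m. \<mu> k * u (x k))" for u
  proof -
    have "(\<integral>k. u (X k) \<partial>M) = (\<Sum>k\<in>{..m}. u (X k) * pmf M k)"
      using setM by (intro integral_measure_pmf_real) auto
    also have "\<dots> = (\<Sum>k\<le>m. \<mu> k * u (x k))"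
      by (rule sum.cong) (auto simp: X_def pmfM)
    finally show ?thesis .
  qed
  have Elam: "(\<integral>k. lagr_lambda m g (X k) l' \<partial>M) = (\<Sum>i\<le>m. l' i * (\<Sum>k\<le>m. \<mu> k * G i (x k)))" for l'
  proof -
    have "lagr_lambda m g y l' = (\<Sum>i\<le>m. l' i * G i y)" for y
      unfolding lagr_lambda_def by (rule sum.mono_neutral_cong_left) (auto simp: G_def)
    then have "(\<integral>k. lagr_lambda m g (X k) l' \<partial>M) = (\<Sum>k\<le>m. \<Sum>i\<le>m. l' i * (\<mu> k * G i (x k)))"
      by (simp add: E[of "\<lambda>y. \<Sum>i\<le>m. l' i * G i y"] sum_distrib_left mult.left_commute)
    also have "\<dots> = (\<Sum>i\<le>m. \<Sum>k\<le>m. l' i * (\<mu> k * G i (x k)))"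
      by (rule sum.swap)
    finally show ?thesis by (simp add: sum_distrib_left)
  qed
  have "is_minimum (\<integral>k. lagr_theta m g gt (X k) l \<partial>M) ((\<lambda>y. lagr_theta m g gt y l) ` topspace T)"
  proof -
    \<comment> \<open>\<open>v\<close> is an average of values that are all at least
      \<open>v\<close>, so each atom of nonzero weight attains it; this shows that the minimum is
      attained.\<close>
    define v where "v = (\<Sum>k\<le>m. \<mu> k * L (x k) l)"
    obtain k where k: "k \<le> m" "\<mu> k \<noteq> 0"
      using standard_simplex_sum[OF \<mu>] by (metis atMost_iff sum.neutral zero_neq_one)
    have "(\<Sum>k\<le>m. \<mu> k * (L (x k) l - v)) = v - (\<Sum>k\<le>m. \<mu> k) * v"
      by (simp add: right_diff_distrib sum_subtractf v_def sum_distrib_right)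
    then have "(\<Sum>k\<le>m. \<mu> k * (L (x k) l - v)) = 0"
      using standard_simplex_sum[OF \<mu>] by simp
    then have "\<mu> k * (L (x k) l - v) = 0"
      using k(1) \<mu>0 min[OF x] by (subst (asm) sum_nonneg_eq_0_iff) (auto simp: v_def)
    then have "v = L (x k) l" using k by simp
    then have "v \<in> (\<lambda>y. L y l) ` topspace T" using x[OF k(1)] by blast
    moreover have "(\<integral>k. L (X k) l \<partial>M) = v" using E[of "\<lambda>y. L y l"] by (simp add: v_def)
    ultimately show ?thesis
      using min by (auto simp: is_minimum_def v_def simp flip: L_def)
  qed
  moreover have "is_maximum (\<integral>k. lagr_lambda m g (X k) l \<partial>M)
      ((\<lambda>l'. \<integral>k. lagr_lambda m g (X k) l' \<partial>M) ` standard_simplex m)"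
  proof -
    \<comment> \<open>\<open>vi\<close> compares with the vertices only; averaging it with the
      weights \<open>l'\<close> covers the whole simplex.\<close>
    have "(\<Sum>i\<le>m. l' i * (\<Sum>k\<le>m. \<mu> k * G i (x k))) \<le> (\<Sum>i\<le>m. l i * (\<Sum>k\<le>m. \<mu> k * G i (x k)))"
      (is "_ \<le> ?v") if l': "l' \<in> standard_simplex m" for l'
    proof -
      have "(\<Sum>i\<le>m. l' i * (\<Sum>k\<le>m. \<mu> k * G i (x k))) \<le> (\<Sum>i\<le>m. l' i * ?v)"
        using vi standard_simplex_ge_0[OF l'] by (auto intro!: sum_mono[of "{..m}" "\<lambda>i. l' i * _ i"] mult_left_mono)
      also have "\<dots> = ?v" using standard_simplex_sum[OF l'] by (simp flip: sum_distrib_right)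
      finally show ?thesis .
    qed
    then show ?thesis using l by (auto simp: is_maximum_def Elam)
  qed
  moreover have "X \<in> measure_pmf M \<rightarrow>\<^sub>M borel_on T"
    \<comment> \<open>Every set is measurable for \<open>measure_pmf\<close>, so it suffices that
      the values lie in the space.\<close>
    using X by (auto simp: borel_on_def space_measure_of_conv)
  ultimately have "mixed_nash T m g gt (measure_pmf M) X l"
    unfolding mixed_nash_def using l by (auto intro: prob_space_measure_pmf)
  moreover have "supported_on_at_most T (measure_pmf M) X (m + 1)"
    unfolding supported_on_at_most_def
  proof (intro exI conjI)
    show "X ` {..m} \<subseteq> topspace T" using X by blast
    show "card (X ` {..m}) \<le> m + 1" using card_image_le[of "{..m}" X] by simp
    show "AE k in measure_pmf M. X k \<in> X ` {..m}" using setM by (auto simp: AE_measure_pmf_iff)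
  qed simp
  ultimately show ?thesis by blast
qed

end
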